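(* Let $L,L'$ be Lie algebras over a field $F$ and let $\varphi:L\to L'$ be a surjective Lie algebra homomorphism. If $A=\mu_A$ and $B=\mu_B$ are complex fuzzy ideals of $L$ such that $A$ is homogeneous with $B$, then $\varphi(A+B)=\varphi(A)+\varphi(B)$.
   Context: A complex fuzzy set $A$ on a nonempty set $X$ is given by a membership function $\mu_A$ with values in the closed unit disc of the complex plane, represented as $\mu_A(x)=r_A(x)e^{iw_A(x)}$ with $r_A:X\to[0,1]$ and $w_A:X\to[0,2\pi]$ (the functions $r_A,w_A$ are part of the data, so a value is treated as a pair $(r,w)$). Values are compared by $r_1e^{iw_1}\le r_2e^{iw_2}$ iff $r_1\le r_2$ and $w_1\le w_2$; $\wedge$, $\vee$ and $\sup$ denote minimum, maximum and supremum, taken componentwise in $(r,w)$. $A$ is homogeneous if for all $x,y\in X$: $r_A(x)\le r_A(y)$ iff $w_A(x)\le w_A(y)$. For complex fuzzy sets $A,B$ on $X$, $A$ is homogeneous with $B$ if for all $x,y\in X$: $r_A(x)\le r_B(y)$ iff $w_A(x)\le w_B(y)$. The complex fuzzy sum of complex fuzzy sets $A,B$ on a Lie algebra is given by $\mu_{A+B}(x)=\sup_{x=a+b}\{\mu_A(a)\wedge\mu_B(b)\}$. The image of a complex fuzzy set $A$ on $X$ under $f:X\to Y$ is the complex fuzzy set $f(A)$ on $Y$ with $\mu_{f(A)}(y)=\sup_{x\in f^{-1}(y)}\mu_A(x)$ if $y\in f(X)$ and $\mu_{f(A)}(y)=0$ otherwise. Equality of complex fuzzy sets means equality of membership functions.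 A complex fuzzy ideal of a Lie algebra $L$ over $F$ is a homogeneous complex fuzzy set $\mu_A$ on $L$ such that for all $x,y\in L$, $\alpha\in F$: (i) $\mu_A(x+y)\ge\mu_A(x)\wedge\mu_A(y)$; (ii) $\mu_A(\alpha x)\ge\mu_A(x)$; (iii) $\mu_A([x,y])\ge\mu_A(x)\vee\mu_A(y)$. *)

theory Defs
  imports Complex_Main "HOL-Library.Product_Order"
begin

locale lie_algebra = vector_space scale
  for scale :: "'f::field \<Rightarrow> 'a::ab_group_add \<Rightarrow> 'a" (infixr \<open>*s\<close> 75) +
  fixes bracket :: "'a \<Rightarrow> 'a \<Rightarrow> 'a"
  assumes bracket_add_left: "bracket (x + y) z = bracket x z + bracket y z"
    and bracket_add_right: "bracket x (y + z) = bracket x y + bracket x z"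
    and bracket_scale_left: "bracket (c *s x) y = c *s bracket x y"
    and bracket_scale_right: "bracket x (c *s y) = c *s bracket x y"
    and bracket_self: "bracket x x = 0"
    and jacobi: "bracket x (bracket y z) + bracket y (bracket z x) + bracket z (bracket x y) = 0"

locale lie_algebra_hom =
  L1: lie_algebra scale1 bracket1 +
  L2: lie_algebra scale2 bracket2 +
  Vector_Spaces.linear scale1 scale2 \<phi>
  for scale1 :: "'f::field \<Rightarrow> 'a::ab_group_add \<Rightarrow> 'a"
    and bracket1 :: "'a \<Rightarrow> 'a \<Rightarrow> 'a"
    and scale2 :: "'f \<Rightarrow> 'b::ab_group_add \<Rightarrow> 'b"
    and bracket2 :: "'b \<Rightarrow> 'b \<Rightarrow> 'b"
    and \<phi> :: "'a \<Rightarrow> 'b" +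
  assumes hom_bracket: "\<phi> (bracket1 x y) = bracket2 (\<phi> x) (\<phi> y)"

text \<open>
  A membership value \<open>r e\<^sup>i\<^sup>w\<close> is represented by the pair \<open>(r, w)\<close> of amplitude and phase, so that
  the phases \<open>0\<close> and \<open>2\<pi>\<close> are distinguished and the phase is retained when \<open>r = 0\<close>. The
  theory \<open>Product_Order\<close> makes \<open>\<le>\<close>, \<open>inf\<close>, \<open>sup\<close> and \<open>Sup\<close> on pairs componentwise, as required.
\<close>

type_synonym 'x cfs = "'x \<Rightarrow> real \<times> real"

abbreviation amplitude :: "'x cfs \<Rightarrow> 'x \<Rightarrow> real"
  where "amplitude A x \<equiv> fst (A x)"

abbreviation phase :: "'x cfs \<Rightarrow> 'x \<Rightarrow> real"
  where "phase A x \<equiv> snd (A x)"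

definition complex_fuzzy_set :: "'x cfs \<Rightarrow> bool"
  where "complex_fuzzy_set A \<longleftrightarrow>
    (\<forall>x. amplitude A x \<in> {0..1} \<and> phase A x \<in> {0..2 * pi})"

definition homogeneous :: "'x cfs \<Rightarrow> bool"
  where "homogeneous A \<longleftrightarrow>
    (\<forall>x y. amplitude A x \<le> amplitude A y \<longleftrightarrow> phase A x \<le> phase A y)"

definition homogeneous_with :: "'x cfs \<Rightarrow> 'x cfs \<Rightarrow> bool"
  where "homogeneous_with A B \<longleftrightarrow>
    (\<forall>x y. amplitude A x \<le> amplitude B y \<longleftrightarrow> phase A x \<le> phase B y)"

text \<open>
  \<open>Sup\<close> on \<open>real\<close> is meaningful only for nonempty bounded sets. For complex fuzzy sets the sets
  below are bounded by \<open>(1, 2\<pi>)\<close>; the first contains the decomposition \<open>x = x + 0\<close>, and the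
  second is used only when the fibre is nonempty.
\<close>

definition cfs_sum :: "'a::ab_group_add cfs \<Rightarrow> 'a cfs \<Rightarrow> 'a cfs"
  where "cfs_sum A B x = Sup {inf (A a) (B b) | a b. x = a + b}"

definition cfs_image :: "('x \<Rightarrow> 'y) \<Rightarrow> 'x cfs \<Rightarrow> 'y cfs"
  where "cfs_image f A y = (if y \<in> range f then Sup (A ` (f -` {y})) else (0, 0))"

definition complex_fuzzy_ideal ::
    "('f::field \<Rightarrow> 'a::ab_group_add \<Rightarrow> 'a) \<Rightarrow> ('a \<Rightarrow> 'a \<Rightarrow> 'a) \<Rightarrow> 'a cfs \<Rightarrow> bool"
  where "complex_fuzzy_ideal scale bracket A \<longleftrightarrow>
    complex_fuzzy_set A \<and> homogeneous A \<and>
    (\<forall>x y. inf (A x) (A y) \<le> A (x + y)) \<and>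
    (\<forall>c x. A x \<le> A (scale c x)) \<and>
    (\<forall>x y. sup (A x) (A y) \<le> A (bracket x y))"

end

theory Submission
  imports Defs
begin

text \<open>
  Suprema, infima and the order on membership values are all componentwise, so the identity
  splits into one identity between real-valued functions for the amplitudes and one for the
  phases, both instances of \<open>Sup_fibre_sup_convolution\<close>. In a linear order an element lies
  strictly below a supremum exactly when it lies strictly below some member, and strictly below
  a minimum exactly when it lies strictly below both arguments. Hence, writing \<open>f\<close> and \<open>g\<close> for
  the component of \<open>A\<close> and \<open>B\<close> at hand, a real \<open>c\<close> lies strictly below either side at \<open>y\<close>
  exactly when there are \<open>a\<close> and \<open>b\<close> with \<open>\<phi> a + \<phi> b = y\<close>, \<open>c < f a\<close> and \<open>c < g b\<close>: on the left
  the first condition arises as \<open>\<phi> (a + b) = y\<close>, on the right by choosing representatives in the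
  fibres over the two summands of \<open>y\<close>. Two elements of a linear order with the same strict lower
  bounds are equal. Working with strict lower bounds avoids having to assume that any of the
  suprema is attained.
\<close>

lemma eq_if_same_strict_lower_bounds:
  fixes u v :: "'c::linorder"
  assumes "\<And>c. c < u \<longleftrightarrow> c < v"
  shows "u = v"
  using assms by (metis linorder_neq_iff order_less_irrefl)

text \<open>
  The identity for one component. Boundedness serves to make every supremum meaningful;
  surjectivity ensures that no supremum over a fibre is taken over the empty set.
\<close>

lemma Sup_fibre_sup_convolution:
  fixes f g :: "'a::ab_group_add \<Rightarrow> 'c::conditionally_complete_linorder"
    and \<phi> :: "'a \<Rightarrow> 'b::ab_group_add"
  assumes add: "\<And>a b. \<phi> (a + b) = \<phi> a + \<phi> b"
    and surj: "surj \<phi>"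
    and f: "\<And>a. f a \<le> M"
    and g: "\<And>a. g a \<le> M"
  shows "(SUP x\<in>\<phi> -` {y}. Sup {min (f a) (g b) | a b. x = a + b}) =
    Sup {min (SUP a\<in>\<phi> -` {p}. f a) (SUP b\<in>\<phi> -` {q}. g b) | p q. y = p + q}"
    (is "?L = ?R")
proof (rule eq_if_same_strict_lower_bounds)
  fix c
  have fibre: "\<phi> -` {p} \<noteq> {}" for p
    using surj by (metis empty_iff surjD vimage_singleton_eq)
  have less_fibre_sup: "c < (SUP a\<in>\<phi> -` {p}. h a) \<longleftrightarrow> (\<exists>a. \<phi> a = p \<and> c < h a)"
    if "\<And>a. h a \<le> M" for h :: "'a \<Rightarrow> 'c" and p
  proof -
    have bdd: "bdd_above (h ` (\<phi> -` {p}))"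
      using that by (auto intro!: bdd_aboveI[of _ M])
    show ?thesis
      unfolding less_cSUP_iff[OF fibre bdd] by auto
  qed
  have fibre_sup_le: "(SUP a\<in>\<phi> -` {p}. h a) \<le> M" if "\<And>a. h a \<le> M" for h :: "'a \<Rightarrow> 'c" and p
    using that by (intro cSUP_least fibre)

  have conv_nonempty: "{min (f a) (g b) | a b. x = a + b} \<noteq> {}" for x
    by simp (metis add_0)
  have conv_le: "s \<le> M" if "s \<in> {min (f a) (g b) | a b. x = a + b}" for s x
    using that f by (auto intro: min.coboundedI1)
  have less_conv: "c < Sup {min (f a) (g b) | a b. x = a + b} \<longleftrightarrow>
      (\<exists>a b. x = a + b \<and> c < f a \<and> c < g b)" for x
  proof -
    have "bdd_above {min (f a) (g b) | a b. x = a + b}"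
      by (rule bdd_aboveI[OF conv_le])
    from less_cSup_iff[OF conv_nonempty this] have
      "c < Sup {min (f a) (g b) | a b. x = a + b} \<longleftrightarrow>
        (\<exists>s\<in>{min (f a) (g b) | a b. x = a + b}. c < s)" .
    also have "\<dots> \<longleftrightarrow> (\<exists>a b. x = a + b \<and> c < min (f a) (g b))"
      by blast
    finally show ?thesis
      by simp
  qed
  have "c < ?L \<longleftrightarrow> (\<exists>x. \<phi> x = y \<and> c < Sup {min (f a) (g b) | a b. x = a + b})"
    by (intro less_fibre_sup cSup_least conv_nonempty conv_le)
  also have "\<dots> \<longleftrightarrow> (\<exists>a b. \<phi> a + \<phi> b = y \<and> c < f a \<and> c < g b)"
    unfolding less_conv by (metis add)
  finally have L: "c < ?L \<longleftrightarrow> (\<exists>a b. \<phi> a + \<phi> b = y \<and> c < f a \<and> c < g b)" .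

  let ?S = "{min (SUP a\<in>\<phi> -` {p}. f a) (SUP b\<in>\<phi> -` {q}. g b) | p q. y = p + q}"
  have "?S \<noteq> {}"
    by simp (metis add_0)
  moreover have "bdd_above ?S"
    using fibre_sup_le[OF f] by (auto intro!: bdd_aboveI[of _ M] intro: min.coboundedI1)
  ultimately have "c < ?R \<longleftrightarrow> (\<exists>s\<in>?S. c < s)"
    by (rule less_cSup_iff)
  also have "\<dots> \<longleftrightarrow> (\<exists>p q. y = p + q \<and>
      c < min (SUP a\<in>\<phi> -` {p}. f a) (SUP b\<in>\<phi> -` {q}. g b))"
    by blast
  also have "\<dots> \<longleftrightarrow> (\<exists>a b. \<phi> a + \<phi> b = y \<and> c < f a \<and> c < g b)"
    unfolding min_less_iff_conj less_fibre_sup[OF f] less_fibre_sup[OF g] by auto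
  finally show "c < ?L \<longleftrightarrow> c < ?R"
    using L by simp
qed

lemma fst_cfs_sum:
  "fst (cfs_sum A B x) = Sup {min (fst (A a)) (fst (B b)) | a b. x = a + b}"
  unfolding cfs_sum_def fst_Sup by (rule arg_cong[where f = Sup]) (force simp: inf_min image_iff)

lemma snd_cfs_sum:
  "snd (cfs_sum A B x) = Sup {min (snd (A a)) (snd (B b)) | a b. x = a + b}"
  unfolding cfs_sum_def snd_Sup by (rule arg_cong[where f = Sup]) (force simp: inf_min image_iff)

lemma fst_cfs_image:
  assumes "surj f"
  shows "fst (cfs_image f A y) = (SUP x\<in>f -` {y}. fst (A x))"
  using assms by (simp add: cfs_image_def fst_Sup image_image)

lemma snd_cfs_image:
  assumes "surj f"
  shows "snd (cfs_image f A y) = (SUP x\<in>f -` {y}. snd (A x))"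
  using assms by (simp add: cfs_image_def snd_Sup image_image)

lemma cfs_image_cfs_sum:
  fixes \<phi> :: "'a::ab_group_add \<Rightarrow> 'b::ab_group_add"
  assumes add: "\<And>a b. \<phi> (a + b) = \<phi> a + \<phi> b"
    and surj: "surj \<phi>"
    and A: "complex_fuzzy_set A"
    and B: "complex_fuzzy_set B"
  shows "cfs_image \<phi> (cfs_sum A B) = cfs_sum (cfs_image \<phi> A) (cfs_image \<phi> B)"
proof (rule ext, rule prod_eqI)
  fix y
  have "fst (A x) \<le> 1" "fst (B x) \<le> 1" for x
    using A B by (auto simp: complex_fuzzy_set_def)
  then show "fst (cfs_image \<phi> (cfs_sum A B) y) =
      fst (cfs_sum (cfs_image \<phi> A) (cfs_image \<phi> B) y)"
    unfolding fst_cfs_sum fst_cfs_image[OF surj] by (rule Sup_fibre_sup_convolution[OF add surj])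
  have "snd (A x) \<le> 2 * pi" "snd (B x) \<le> 2 * pi" for x
    using A B by (auto simp: complex_fuzzy_set_def)
  then show "snd (cfs_image \<phi> (cfs_sum A B) y) =
      snd (cfs_sum (cfs_image \<phi> A) (cfs_image \<phi> B) y)"
    unfolding snd_cfs_sum snd_cfs_image[OF surj] by (rule Sup_fibre_sup_convolution[OF add surj])
qed

theorem theorem18:
  fixes scale1 :: "'f::field \<Rightarrow> 'a::ab_group_add \<Rightarrow> 'a"
    and bracket1 :: "'a \<Rightarrow> 'a \<Rightarrow> 'a"
    and scale2 :: "'f \<Rightarrow> 'b::ab_group_add \<Rightarrow> 'b"
    and bracket2 :: "'b \<Rightarrow> 'b \<Rightarrow> 'b"
    and \<phi> :: "'a \<Rightarrow> 'b"
    and A B :: "'a cfs"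
  assumes "lie_algebra scale1 bracket1"
    and "lie_algebra scale2 bracket2"
    and "lie_algebra_hom scale1 bracket1 scale2 bracket2 \<phi>"
    and "surj \<phi>"
    and "complex_fuzzy_ideal scale1 bracket1 A"
    and "complex_fuzzy_ideal scale1 bracket1 B"
    and "homogeneous_with A B"
  shows "cfs_image \<phi> (cfs_sum A B) = cfs_sum (cfs_image \<phi> A) (cfs_image \<phi> B)"
proof (rule cfs_image_cfs_sum)
  interpret lie_algebra_hom scale1 bracket1 scale2 bracket2 \<phi>
    by fact
  show "\<phi> (a + b) = \<phi> a + \<phi> b" for a b
    by (rule add)
qed (use assms in \<open>auto simp: complex_fuzzy_ideal_def\<close>)

end
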